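(* Suppose $X$ is a real random variable with moment generating function $\phi(t)=\mathbb{E}\exp(tX)$ defined (finite) for $t\in T\subseteq\mathbb{R}$. Then for any $x>0$, $$\mathbb{P}(X\ge x)\ge\sup_{\substack{\theta,\delta>1,\ t\ge t'\ge0\\ t\theta\in T}}\left\{\phi(t)\exp(-t\delta x)-\phi(t\theta)\exp(-t\delta\theta x)-\exp(-(t\delta-t')x)\,\phi(t-t')\right\}$$ and $$\mathbb{P}(X\le-x)\ge\sup_{\substack{\theta,\delta>1,\ t\ge t'\ge0\\ -t\theta\in T}}\left\{\phi(-t)\exp(-t\delta x)-\phi(-t\theta)\exp(-t\delta\theta x)-\exp(-(t\delta-t')x)\,\phi(t'-t)\right\}.$$
   Context: The suprema are over all real $\theta,\delta,t,t'$ satisfying the displayed constraints. *)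

theory Defs
  imports "HOL-Probability.Probability"
begin

definition mgf :: "'a measure \<Rightarrow> ('a \<Rightarrow> real) \<Rightarrow> real \<Rightarrow> real"
  where "mgf M X t = (\<integral>\<omega>. exp (t * X \<omega>) \<partial>M)"

text \<open>
  The Bochner integral is 0 for non-integrable functions, so values of \<^const>\<open>mgf\<close> are
  meaningful only where the following predicate holds.
\<close>
definition mgf_finite_at :: "'a measure \<Rightarrow> ('a \<Rightarrow> real) \<Rightarrow> real \<Rightarrow> bool"
  where "mgf_finite_at M X t \<longleftrightarrow> integrable M (\<lambda>\<omega>. exp (t * X \<omega>))"

end

theory Submission
  imports Defs
begin

text \<open>
  A random variable with a large exponential moment at \<open>t\<close> must be large with some probability,
  unless that moment is carried by values that are either very large or small. Fix a threshold
  \<open>\<delta>x > x\<close> and split the normalised moment \<open>E exp (t (X - \<delta>x))\<close> according to the value of \<open>X\<close>.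
  On \<open>X \<ge> \<delta>x\<close> the exponent is nonnegative, so replacing \<open>t\<close> by \<open>t\<theta>\<close> can only increase it.
  On \<open>x \<le> X < \<delta>x\<close> the integrand is at most \<open>1\<close>, and this part costs at most \<open>P (X \<ge> x)\<close>. On
  \<open>X < x\<close> an extra factor \<open>exp (t' (x - X)) \<ge> 1\<close> is free, as in a Chernoff bound. Adding the three
  bounds gives a pointwise inequality (\<open>exp_tilt_three_regions\<close>); integrating it and solving for
  \<open>P (X \<ge> x)\<close> gives \<open>upper_tail_mgf_bound\<close>. All three moments exist as soon as the one at \<open>t\<theta>\<close>
  does, because the exponents lie between \<open>0\<close> and \<open>t\<theta>\<close>. The bound on the lower tail is the bound
  on the upper tail of \<open>-X\<close>.
\<close>

text \<open>
  All three summands are nonnegative, so it suffices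
  that at every \<open>y\<close> a single summand dominates the left-hand side. The third does so for \<open>y < x\<close>;
  for \<open>y \<ge> x\<close> the second or the first does, according to whether \<open>y \<ge> \<delta>x\<close> or not.
\<close>
lemma exp_tilt_three_regions:
  fixes x y t t' \<theta> \<delta> :: real
  assumes "\<theta> \<ge> 1" "0 \<le> t" "0 \<le> t'"
  shows "exp (- t * \<delta> * x) * exp (t * y)
    \<le> indicator {x..} y + exp (- t * \<delta> * \<theta> * x) * exp (t * \<theta> * y)
      + exp (- (t * \<delta> - t') * x) * exp ((t - t') * y)"
proof -
  have lhs: "exp (- t * \<delta> * x) * exp (t * y) = exp (t * (y - \<delta> * x))"
    by (simp add: exp_add [symmetric] algebra_simps)
  have upper: "exp (- t * \<delta> * \<theta> * x) * exp (t * \<theta> * y) = exp (\<theta> * (t * (y - \<delta> * x)))"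
    by (simp add: exp_add [symmetric] algebra_simps)
  have lower: "exp (- (t * \<delta> - t') * x) * exp ((t - t') * y)
      = exp (t * (y - \<delta> * x) + t' * (x - y))"
    by (simp add: exp_add [symmetric] algebra_simps)
  have "exp (t * (y - \<delta> * x))
    \<le> indicator {x..} y + exp (\<theta> * (t * (y - \<delta> * x))) + exp (t * (y - \<delta> * x) + t' * (x - y))"
  proof (cases "y < x")
    case True
    then have "t' * (x - y) \<ge> 0" using assms by simp
    then have "exp (t * (y - \<delta> * x)) \<le> exp (t * (y - \<delta> * x) + t' * (x - y))" by simp
    then show ?thesis by (smt (verit) exp_gt_zero indicator_pos_le)
  next
    case False
    then have ind: "indicator {x..} y = (1 :: real)" by simp
    show ?thesis
    proof (cases "y \<ge> \<delta> * x")
      case True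
      then have "0 \<le> t * (y - \<delta> * x)" using assms by simp
      then have "exp (t * (y - \<delta> * x)) \<le> exp (\<theta> * (t * (y - \<delta> * x)))"
        using assms mult_right_mono [of 1 \<theta> "t * (y - \<delta> * x)"] by simp
      then show ?thesis unfolding ind by (smt (verit) exp_gt_zero)
    next
      case False
      then have "exp (t * (y - \<delta> * x)) \<le> 1"
        using assms by (simp add: mult_nonneg_nonpos)
      then show ?thesis unfolding ind by (smt (verit) exp_gt_zero)
    qed
  qed
  then show ?thesis unfolding lhs upper lower .
qed

text \<open>
  Between \<open>0\<close> and \<open>s\<close> the exponential \<open>exp (r y)\<close> is dominated by \<open>1 + exp (s y)\<close>, whatever the
  sign of \<open>y\<close>, and the constant \<open>1\<close> is integrable because the measure is finite.
\<close>
lemma (in finite_measure) mgf_finite_at_between: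
  assumes "X \<in> borel_measurable M" "mgf_finite_at M X s" "0 \<le> r" "r \<le> s"
  shows "mgf_finite_at M X r"
  unfolding mgf_finite_at_def
proof (rule Bochner_Integration.integrable_bound)
  show "integrable M (\<lambda>\<omega>. 1 + exp (s * X \<omega>))"
    using assms(2) unfolding mgf_finite_at_def by simp
  show "(\<lambda>\<omega>. exp (r * X \<omega>)) \<in> borel_measurable M"
    using assms(1) by measurable
  have "exp (r * y) \<le> 1 + exp (s * y)" for y
  proof (cases "y \<ge> 0")
    case True
    then have "exp (r * y) \<le> exp (s * y)" using assms(4) by (simp add: mult_right_mono)
    then show ?thesis by (simp add: add_increasing)
  next
    case False
    then have "exp (r * y) \<le> 1" using assms(3) by (simp add: mult_nonneg_nonpos)
    then show ?thesis by (smt (verit) exp_gt_zero)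
  qed
  then show "AE \<omega> in M. norm (exp (r * X \<omega>)) \<le> norm (1 + exp (s * X \<omega>))" by simp
qed

lemma (in prob_space) upper_tail_mgf_bound:
  assumes X: "X \<in> borel_measurable M"
    and "\<theta> \<ge> 1" "t \<ge> t'" "t' \<ge> 0" "mgf_finite_at M X (t * \<theta>)"
  shows "mgf M X t * exp (- t * \<delta> * x) - mgf M X (t * \<theta>) * exp (- t * \<delta> * \<theta> * x)
      - exp (- (t * \<delta> - t') * x) * mgf M X (t - t') \<le> \<P>(\<omega> in M. X \<omega> \<ge> x)"
proof -
  have t: "0 \<le> t" "t \<le> t * \<theta>"
    using assms mult_left_mono [of 1 \<theta> t] by auto
  have int: "integrable M (\<lambda>\<omega>. exp (s * X \<omega>))" if "0 \<le> s" "s \<le> t * \<theta>" for s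
    using mgf_finite_at_between [OF X assms(5)] that unfolding mgf_finite_at_def .
  have int_t: "integrable M (\<lambda>\<omega>. exp (t * X \<omega>))"
    and int_t\<theta>: "integrable M (\<lambda>\<omega>. exp (t * \<theta> * X \<omega>))"
    and int_diff: "integrable M (\<lambda>\<omega>. exp ((t - t') * X \<omega>))"
    by (rule int; use t assms in simp)+
  have event: "{\<omega> \<in> space M. X \<omega> \<ge> x} \<in> sets M" using X by measurable
  let ?I = "indicator {\<omega> \<in> space M. X \<omega> \<ge> x} :: 'a \<Rightarrow> real"
  have int_I: "integrable M ?I" using event by (simp add: emeasure_eq_measure)
  have "(\<integral>\<omega>. exp (- t * \<delta> * x) * exp (t * X \<omega>) \<partial>M)
      \<le> (\<integral>\<omega>. ?I \<omega> + exp (- t * \<delta> * \<theta> * x) * exp (t * \<theta> * X \<omega>)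
          + exp (- (t * \<delta> - t') * x) * exp ((t - t') * X \<omega>) \<partial>M)"
  proof (rule integral_mono)
    fix \<omega> assume "\<omega> \<in> space M"
    then have "?I \<omega> = indicator {x..} (X \<omega>)" by (simp add: indicator_def)
    then show "exp (- t * \<delta> * x) * exp (t * X \<omega>)
        \<le> ?I \<omega> + exp (- t * \<delta> * \<theta> * x) * exp (t * \<theta> * X \<omega>)
          + exp (- (t * \<delta> - t') * x) * exp ((t - t') * X \<omega>)"
      using exp_tilt_three_regions [of \<theta> t t' \<delta> x "X \<omega>"] assms t by simp
  qed (intro Bochner_Integration.integrable_add integrable_mult_right int_I int_t int_t\<theta> int_diff)+
  also have "\<dots> = \<P>(\<omega> in M. X \<omega> \<ge> x) + exp (- t * \<delta> * \<theta> * x) * mgf M X (t * \<theta>)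
      + exp (- (t * \<delta> - t') * x) * mgf M X (t - t')"
    using int_I int_t\<theta> int_diff event by (simp add: mgf_def del: mult_minus_left)
  finally show ?thesis by (simp add: mgf_def mult.commute)
qed

lemma mgf_uminus: "mgf M (\<lambda>\<omega>. - X \<omega>) t = mgf M X (- t)"
  by (simp add: mgf_def)

lemma mgf_finite_at_uminus: "mgf_finite_at M (\<lambda>\<omega>. - X \<omega>) t \<longleftrightarrow> mgf_finite_at M X (- t)"
  by (simp add: mgf_finite_at_def)

theorem lemma1:
  fixes M :: "'a measure" and X :: "'a \<Rightarrow> real" and T :: "real set"
    and \<phi> :: "real \<Rightarrow> real" and x :: real
  assumes "prob_space M"
    and "X \<in> borel_measurable M"
    and "\<And>t. t \<in> T \<Longrightarrow> mgf_finite_at M X t"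
    and "\<phi> = mgf M X"
    and "x > 0"
  shows "ereal \<P>(\<omega> in M. X \<omega> \<ge> x) \<ge>
      (SUP (\<theta>, \<delta>, t, t') \<in> {(\<theta>, \<delta>, t, t'). \<theta> > 1 \<and> \<delta> > 1 \<and> t \<ge> t' \<and> t' \<ge> 0 \<and> t * \<theta> \<in> T}.
        ereal (\<phi> t * exp (- t * \<delta> * x) - \<phi> (t * \<theta>) * exp (- t * \<delta> * \<theta> * x)
          - exp (- (t * \<delta> - t') * x) * \<phi> (t - t')))
    \<and> ereal \<P>(\<omega> in M. X \<omega> \<le> - x) \<ge>
      (SUP (\<theta>, \<delta>, t, t') \<in> {(\<theta>, \<delta>, t, t'). \<theta> > 1 \<and> \<delta> > 1 \<and> t \<ge> t' \<and> t' \<ge> 0 \<and> - t * \<theta> \<in> T}.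
        ereal (\<phi> (- t) * exp (- t * \<delta> * x) - \<phi> (- t * \<theta>) * exp (- t * \<delta> * \<theta> * x)
          - exp (- (t * \<delta> - t') * x) * \<phi> (t' - t)))"
proof -
  interpret prob_space M by fact
  have upper: "\<phi> t * exp (- t * \<delta> * x) - \<phi> (t * \<theta>) * exp (- t * \<delta> * \<theta> * x)
      - exp (- (t * \<delta> - t') * x) * \<phi> (t - t') \<le> \<P>(\<omega> in M. X \<omega> \<ge> x)"
    if "\<theta> > 1" "t \<ge> t'" "t' \<ge> 0" "t * \<theta> \<in> T" for \<theta> \<delta> t t'
    unfolding assms(4) using that assms by (intro upper_tail_mgf_bound) simp_all
  have lower: "\<phi> (- t) * exp (- t * \<delta> * x) - \<phi> (- t * \<theta>) * exp (- t * \<delta> * \<theta> * x)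
      - exp (- (t * \<delta> - t') * x) * \<phi> (t' - t) \<le> \<P>(\<omega> in M. X \<omega> \<le> - x)"
    if "\<theta> > 1" "t \<ge> t'" "t' \<ge> 0" "- t * \<theta> \<in> T" for \<theta> \<delta> t t'
  proof -
    have "mgf_finite_at M (\<lambda>\<omega>. - X \<omega>) (t * \<theta>)"
      using assms(3) [OF that(4)] by (simp add: mgf_finite_at_uminus)
    moreover have "x \<le> - X \<omega> \<longleftrightarrow> X \<omega> \<le> - x" for \<omega> by linarith
    ultimately show ?thesis
      unfolding assms(4)
      using upper_tail_mgf_bound [of "\<lambda>\<omega>. - X \<omega>" \<theta> t' t \<delta> x] that assms(2)
      by (simp add: mgf_uminus)
  qed
  show ?thesis
    by (intro conjI SUP_least) (use upper lower in \<open>auto simp del: mult_minus_left\<close>)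
qed

end
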